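(* Let $N\ge2$ be an integer, let $\gamma$ be a strictly positive integer, and let $t\ge2\gamma+3$ be an odd integer. The Carvalho--Torres semigroup $U_0=U_0(t)$ is minimally generated by $2N$, $(2\gamma+1)N$ and $Nt-1$ (i.e. has minimal presentation $\langle2,2\gamma+1\rangle N+\langle Nt-1\rangle$), and its effective weight is $$\operatorname{ewt}(U_0)=\left(3\binom N2-(N-1)\right)t+N\gamma-6(N-1).$$
   Context: For a numerical semigroup $S$ (cofinite submonoid of $\mathbb N$) containing $2N$, the standard basis modulo $2N$ is $(e_0=2N,e_1,\dots,e_{2N-1})$, with $e_i$ ($i\ge1$) the smallest nonzero element of $S$ congruent to $i$ modulo $2N$. The Carvalho--Torres semigroup $U_0(t)$ is the numerical semigroup with $e_0=2N$, $e_N=(2\gamma+1)N$, and whose remaining standard basis elements modulo $2N$ are determined by $$\min\{e_{N-j},e_{2N-j}\}=(Nt-1)j,\qquad e_{N-j}+e_{2N-j}=2j(Nt-1)+(2\gamma+1)N\qquad(j=1,\dots,N-1).$$ Its genus is $\binom N2t+N(\gamma-1)+1$. The effective weight $\operatorname{ewt}(S)$ is the number of pairs $0<a<b$ of integers with $a$ a minimal generator of $S$ and $b\notin S$. *)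

theory Defs
  imports Complex_Main "HOL-Number_Theory.Cong"
begin

definition submonoid :: "nat set \<Rightarrow> bool" where
  "submonoid S \<longleftrightarrow> 0 \<in> S \<and> (\<forall>x\<in>S. \<forall>y\<in>S. x + y \<in> S)"

definition numerical_semigroup :: "nat set \<Rightarrow> bool" where
  "numerical_semigroup S \<longleftrightarrow> submonoid S \<and> finite (- S)"

definition generated :: "nat set \<Rightarrow> nat set" where
  "generated A = submonoid hull A"

definition minimally_generates :: "nat set \<Rightarrow> nat set \<Rightarrow> bool" where
  "minimally_generates A S \<longleftrightarrow> generated A = S \<and> (\<forall>B. B \<subset> A \<longrightarrow> generated B \<noteq> S)"

text \<open>A submonoid of the naturals has exactly one minimal generating set, so the existential
  quantifier below picks out the elements of that set.\<close>

definition minimal_generators :: "nat set \<Rightarrow> nat set" where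
  "minimal_generators S = {a. \<exists>A. minimally_generates A S \<and> a \<in> A}"

definition ewt :: "nat set \<Rightarrow> nat" where
  "ewt S = card {(a, b). 0 < a \<and> a < b \<and> a \<in> minimal_generators S \<and> b \<notin> S}"

text \<open>The element \<open>e\<^sub>i\<close> of the standard basis of \<open>S\<close> modulo \<open>m\<close>; meaningful for a numerical
  semigroup \<open>S\<close> containing \<open>m > 0\<close> and for \<open>i < m\<close>.\<close>

definition standard_basis :: "nat set \<Rightarrow> nat \<Rightarrow> nat \<Rightarrow> nat" where
  "standard_basis S m i =
     (if i = 0 then m else (LEAST n. n \<in> S \<and> n \<noteq> 0 \<and> [n = i] (mod m)))"

definition is_carvalho_torres :: "nat \<Rightarrow> nat \<Rightarrow> nat \<Rightarrow> nat set \<Rightarrow> bool" where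
  "is_carvalho_torres N \<gamma> t S \<longleftrightarrow>
     numerical_semigroup S \<and> 2 * N \<in> S \<and>
     (let e = standard_basis S (2 * N) in
        e N = (2 * \<gamma> + 1) * N \<and>
        (\<forall>j. 1 \<le> j \<and> j \<le> N - 1 \<longrightarrow>
           min (e (N - j)) (e (2 * N - j)) = (N * t - 1) * j \<and>
           e (N - j) + e (2 * N - j) = 2 * j * (N * t - 1) + (2 * \<gamma> + 1) * N))"

text \<open>For \<open>N \<ge> 2\<close>, \<open>\<gamma> > 0\<close> and odd \<open>t \<ge> 2 * \<gamma> + 3\<close> there is exactly one such semigroup: since
  \<open>t\<close> is odd, the residue of \<open>(N * t - 1) * j\<close> modulo \<open>2 * N\<close> decides which of the two basis
  elements attains the minimum.\<close>

definition carvalho_torres :: "nat \<Rightarrow> nat \<Rightarrow> nat \<Rightarrow> nat set" where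
  "carvalho_torres N \<gamma> t = (THE S. is_carvalho_torres N \<gamma> t S)"

end

theory Submission
  imports Defs
begin

text \<open>
  Write \<open>q = N t - 1\<close> and \<open>h = (2 \<gamma> + 1) N\<close>, so that \<open>2 N < h < q\<close> and \<open>q\<close> is congruent to \<open>-1\<close>
  modulo \<open>N\<close>. Let \<open>G\<close> be the monoid generated by \<open>2 N\<close>, \<open>h\<close> and \<open>q\<close>.

  The monoid \<open>G\<close> is the Carvalho--Torres semigroup because its standard basis modulo \<open>2 N\<close> consists,
  apart from the element for the residue \<open>0\<close>, of the nonzero sums \<open>\<epsilon> h + j q\<close> with \<open>\<epsilon>\<close> in \<open>{0, 1}\<close>
  and \<open>j < N\<close> (\<open>generated_minimum\<close>): the residue modulo \<open>N\<close> forces an element of the same class to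
  use \<open>q\<close> at least \<open>j\<close> times, and parity then decides whether \<open>h\<close> is needed. For fixed \<open>j > 0\<close> the
  two sums, with \<open>\<epsilon> = 0\<close> and \<open>\<epsilon> = 1\<close>, lie in the classes of \<open>N - j\<close> and \<open>2 N - j\<close>, in an order
  given by the parity of \<open>j\<close>, which gives the
  prescribed minimum and sum. No other semigroup has these properties: the residue of \<open>j q\<close> tells
  which of the two classes attains the minimum, so the whole standard basis is prescribed, and it
  determines the semigroup (\<open>basis_unique\<close>, \<open>semigroup_eqI\<close>).

  The three generators are minimal: \<open>2 N\<close> is smaller than the others, \<open>h\<close> is below \<open>q\<close> and is
  not a multiple of \<open>2 N\<close>, and \<open>q\<close> is not a multiple of \<open>N\<close>.

  For the effective weight, fix a generator \<open>a\<close>. The gaps above \<open>a\<close> are all gaps except those below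
  \<open>a\<close>, and the latter are counted by \<open>a\<close> minus the number of elements of \<open>G\<close> below \<open>a\<close>. Hence
  \<open>ewt G\<close> is the sum over the generators of the genus, plus the number of elements below \<open>a\<close>, minus
  \<open>a\<close> (\<open>ewt_eq_sum\<close>). The genus follows from the sum of the standard basis by Selmer's formula
  (\<open>genus_standard_basis\<close>), where only the sums of the pairs of basis elements matter. Below \<open>q\<close>,
  the semigroup is \<open>N\<close> times the semigroup generated by \<open>2\<close> and \<open>2 \<gamma> + 1\<close>, so there are \<open>1\<close>,
  \<open>\<gamma> + 1\<close> and \<open>t - \<gamma>\<close> elements below the respective generators.
\<close>

section \<open>Generated submonoids and minimal generators\<close>

lemma submonoid_generated: "submonoid (generated A)"
  unfolding generated_def by (rule hull_in) (auto simp: submonoid_def)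

lemma generated_superset: "A \<subseteq> generated A"
  unfolding generated_def by (rule hull_subset)

lemma generated_least: "A \<subseteq> T \<Longrightarrow> submonoid T \<Longrightarrow> generated A \<subseteq> T"
  unfolding generated_def by (rule hull_minimal)

lemma generated_mono: "A \<subseteq> B \<Longrightarrow> generated A \<subseteq> generated B"
  unfolding generated_def by (rule hull_mono)

lemma submonoid_zero: "submonoid S \<Longrightarrow> 0 \<in> S"
  and submonoid_add: "submonoid S \<Longrightarrow> x \<in> S \<Longrightarrow> y \<in> S \<Longrightarrow> x + y \<in> S"
  by (auto simp: submonoid_def)

lemma submonoid_mult:
  assumes "submonoid S" "x \<in> S"
  shows "k * x \<in> S"
  by (induction k) (use assms in \<open>auto simp: submonoid_def\<close>)

lemma generated_empty: "generated {} = {0}"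
proof
  show "generated {} \<subseteq> {0}"
    by (rule generated_least) (auto simp: submonoid_def)
  show "{0} \<subseteq> generated {}"
    using submonoid_zero[OF submonoid_generated] by simp
qed

lemma generated_insert:
  "generated (insert a A) = {k * a + y | k y. y \<in> generated A}" (is "_ = ?R")
proof
  have "submonoid ?R"
    unfolding submonoid_def
  proof (intro conjI ballI)
    have "0 = 0 * a + 0" by simp
    then show "0 \<in> ?R"
      using submonoid_zero[OF submonoid_generated, of A] by blast
  next
    fix u v assume "u \<in> ?R" "v \<in> ?R"
    then obtain k y l z where "u = k * a + y" "y \<in> generated A" "v = l * a + z" "z \<in> generated A"
      by blast
    then have "u + v = (k + l) * a + (y + z)" "y + z \<in> generated A"
      by (auto simp: algebra_simps submonoid_add submonoid_generated)
    then show "u + v \<in> ?R" by blast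
  qed
  moreover have "insert a A \<subseteq> ?R"
  proof -
    have "a = 1 * a + 0" "\<And>x. x = 0 * a + x" by simp_all
    then show ?thesis
      using submonoid_zero[OF submonoid_generated, of A] generated_superset[of A] by blast
  qed
  ultimately show "generated (insert a A) \<subseteq> ?R"
    by (intro generated_least)
next
  have "a \<in> generated (insert a A)" "generated A \<subseteq> generated (insert a A)"
    using generated_superset[of "insert a A"] generated_mono[of A "insert a A"] by auto
  then show "?R \<subseteq> generated (insert a A)"
    by (auto intro!: submonoid_add submonoid_mult submonoid_generated)
qed

lemma generated_singleton: "generated {a} = {k * a | k. True}"
  by (simp add: generated_insert generated_empty)

lemma generated_pair: "generated {a, b} = {k * a + l * b | k l. True}"
  unfolding generated_insert[of a "{b}"] generated_singleton by blast

lemma generated_triple: "generated {a, b, c} = {k * a + l * b + m * c | k l m. True}"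
  unfolding generated_insert[of a "{b, c}"] generated_pair
  by (auto simp: add.assoc)

text \<open>The nonzero elements that are not sums of two nonzero elements. They form the unique minimal
  generating set, so they make the minimal generators computable from a single minimally
  generating set.\<close>

definition atoms :: "nat set \<Rightarrow> nat set" where
  "atoms S = {a \<in> S. a \<noteq> 0 \<and> (\<forall>x\<in>S. \<forall>y\<in>S. a = x + y \<longrightarrow> x = 0 \<or> y = 0)}"

text \<open>Removing an atom from a submonoid leaves a submonoid, so a generating set cannot avoid it.\<close>

lemma atoms_subset_generators:
  assumes "generated A = S"
  shows "atoms S \<subseteq> A"
proof
  fix a assume a: "a \<in> atoms S"
  show "a \<in> A"
  proof (rule ccontr)
    assume "a \<notin> A"
    have "submonoid S" using submonoid_generated assms by metis
    have "x + y \<noteq> a" if "x \<in> S - {a}" "y \<in> S - {a}" for x y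
    proof
      assume "x + y = a"
      then have "x = 0 \<or> y = 0" using a that unfolding atoms_def by blast
      then show False using \<open>x + y = a\<close> that by auto
    qed
    then have "submonoid (S - {a})"
      using a \<open>submonoid S\<close> unfolding submonoid_def atoms_def by simp
    moreover have "A \<subseteq> S - {a}"
      using generated_superset[of A] assms \<open>a \<notin> A\<close> by auto
    ultimately have "S \<subseteq> S - {a}"
      using generated_least assms by metis
    then show False using a by (auto simp: atoms_def)
  qed
qed

lemma generated_atoms:
  assumes "submonoid S"
  shows "generated (atoms S) = S"
proof
  show "generated (atoms S) \<subseteq> S"
    using assms by (intro generated_least) (auto simp: atoms_def)
  have "n \<in> S \<longrightarrow> n \<in> generated (atoms S)" for n
  proof (induction n rule: less_induct)
    case (less n)
    show ?case
    proof
      assume n: "n \<in> S"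
      consider "n = 0" | "n \<in> atoms S"
        | x y where "x \<in> S" "y \<in> S" "n = x + y" "x \<noteq> 0" "y \<noteq> 0"
        using n unfolding atoms_def by blast
      then show "n \<in> generated (atoms S)"
      proof cases
        case 1
        then show ?thesis using submonoid_zero submonoid_generated by simp
      next
        case 2
        then show ?thesis using generated_superset by blast
      next
        case 3
        then have "x < n" "y < n" by auto
        then show ?thesis using 3 less submonoid_add[OF submonoid_generated] by simp
      qed
    qed
  qed
  then show "S \<subseteq> generated (atoms S)" by blast
qed

lemma minimally_generates_imp_atoms:
  assumes "minimally_generates A S"
  shows "A = atoms S"
proof -
  have gen: "generated A = S" and min: "\<And>B. B \<subset> A \<Longrightarrow> generated B \<noteq> S"
    using assms by (auto simp: minimally_generates_def)
  have "submonoid S" using gen submonoid_generated by metis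
  then show ?thesis
    using atoms_subset_generators[OF gen] min[of "atoms S"] generated_atoms by blast
qed

lemma minimal_generators_eq:
  assumes "minimally_generates A S"
  shows "minimal_generators S = A"
  using assms minimally_generates_imp_atoms unfolding minimal_generators_def by blast

text \<open>It is enough to drop one generator at a time, because a proper subset lies in the complement
  of one generator and generation is monotone.\<close>

lemma minimally_generatesI:
  assumes "generated A = S" and "\<And>a. a \<in> A \<Longrightarrow> a \<notin> generated (A - {a})"
  shows "minimally_generates A S"
  unfolding minimally_generates_def
proof (intro conjI allI impI)
  show "generated A = S" by fact
  fix B assume "B \<subset> A"
  then obtain a where a: "a \<in> A" "B \<subseteq> A - {a}" by blast
  then have "a \<in> S" "a \<notin> generated B"
    using assms generated_superset generated_mono by blast+
  then show "generated B \<noteq> S" by blast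
qed

section \<open>Standard basis and genus\<close>

lemma standard_basis_eqI:
  assumes "0 < i" "i < m" "w \<in> S" "[w = i] (mod m)"
    and "\<And>n. n \<in> S \<Longrightarrow> [n = i] (mod m) \<Longrightarrow> w \<le> n"
  shows "standard_basis S m i = w"
proof -
  have "w \<noteq> 0" using assms(1,2,4) by (cases "w = 0") (auto simp: cong_def)
  then have "(LEAST n. n \<in> S \<and> n \<noteq> 0 \<and> [n = i] (mod m)) = w"
    using assms by (intro Least_equality) auto
  then show ?thesis using assms(1) by (simp add: standard_basis_def)
qed

locale semigroup_modulo =
  fixes S :: "nat set" and m :: nat
  assumes numerical: "numerical_semigroup S" and m_in: "m \<in> S" and m_pos: "0 < m"
begin

abbreviation e :: "nat \<Rightarrow> nat" where "e \<equiv> standard_basis S m"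

lemma submonoid: "submonoid S"
  using numerical by (simp add: numerical_semigroup_def)

lemma standard_basis_props:
  assumes "0 < i" "i < m"
  shows "e i \<in> S" "[e i = i] (mod m)" "\<And>n. n \<in> S \<Longrightarrow> [n = i] (mod m) \<Longrightarrow> e i \<le> n"
proof -
  let ?P = "\<lambda>n. n \<in> S \<and> n \<noteq> 0 \<and> [n = i] (mod m)"
  have e: "e i = (LEAST n. ?P n)" using assms by (simp add: standard_basis_def)
  have "\<not> finite {n. [n = i] (mod m)}"
  proof -
    have "(\<lambda>k. i + k * m) ` UNIV \<subseteq> {n. [n = i] (mod m)}" by (auto simp: cong_def)
    moreover have "inj (\<lambda>k. i + k * m)" using m_pos by (auto intro: injI)
    ultimately show ?thesis using finite_subset finite_imageD infinite_UNIV_nat by metis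
  qed
  moreover have "finite (- S)" using numerical by (simp add: numerical_semigroup_def)
  ultimately have "\<not> {n. [n = i] (mod m)} \<subseteq> - S" using finite_subset by blast
  then obtain n where n: "n \<in> S" "[n = i] (mod m)" by blast
  have nz: "k \<noteq> 0" if "[k = i] (mod m)" for k
    using that assms by (cases "k = 0") (auto simp: cong_def)
  have "?P n" using n nz by blast
  then have "?P (e i)" unfolding e by (rule LeastI)
  then show "e i \<in> S" "[e i = i] (mod m)" by auto
  fix k assume "k \<in> S" "[k = i] (mod m)"
  then have "?P k" using nz by blast
  then show "e i \<le> k" unfolding e by (rule Least_le)
qed

text \<open>The elements of a residue class that lie in the semigroup are an upward closed progression
  starting at the basis element. The residue \<open>0\<close> is separate, since there the standard basis
  has \<open>m\<close> although the class starts at \<open>0\<close>.\<close>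

lemma mem_iff: "n \<in> S \<longleftrightarrow> n mod m = 0 \<or> e (n mod m) \<le> n"
proof (cases "n mod m = 0")
  case True
  then obtain k where "n = k * m" by (metis mult.commute mod_0_imp_dvd dvdE)
  then show ?thesis using True submonoid m_in submonoid_mult by simp
next
  case False
  let ?i = "n mod m"
  have i: "0 < ?i" "?i < m" using False m_pos by auto
  note p = standard_basis_props[OF i]
  have "n \<in> S" if le: "e ?i \<le> n"
  proof -
    have "[n = e ?i] (mod m)" using p(2) by (simp add: cong_def)
    then obtain k where "n = k * m + e ?i" using cong_le_nat[OF le] by auto
    moreover have "k * m + e ?i \<in> S"
      using submonoid m_in p(1) by (intro submonoid_add submonoid_mult)
    ultimately show ?thesis by simp
  qed
  then show ?thesis using p(3)[of n] False by (auto simp: cong_def)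
qed

text \<open>Selmer's formula: the class of \<open>i\<close> contributes the gaps \<open>i, i + m, \<dots>\<close> below its basis element
  \<open>e i\<close>, and there are \<open>(e i - i) / m\<close> of them. Multiplying by \<open>m\<close> and adding the residues avoids
  division and subtraction.\<close>

lemma genus_standard_basis:
  "m * card (- S) + (\<Sum>i=1..<m. i) = (\<Sum>i=1..<m. e i)"
proof -
  let ?G = "\<lambda>i. {n. n mod m = i \<and> n < e i}"
  have gaps: "- S = (\<Union>i\<in>{1..<m}. ?G i)"
    using m_pos by (auto simp: mem_iff Suc_le_eq not_le)
  have card_gaps: "card (\<Union>i\<in>{1..<m}. ?G i) = (\<Sum>i=1..<m. card (?G i))"
    by (intro card_UN_disjoint) auto
  have class_gaps: "m * card (?G i) + i = e i" if "i \<in> {1..<m}" for i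
  proof -
    have i: "0 < i" "i < m" using that by auto
    let ?k = "e i div m"
    have ei: "e i = i + m * ?k"
      using standard_basis_props(2)[OF i] i mult_div_mod_eq[of m "e i"] by (simp add: cong_def)
    have "?G i = (\<lambda>l. i + m * l) ` {..<?k}"
    proof (intro equalityI subsetI)
      fix n assume "n \<in> ?G i"
      then have n: "n mod m = i" "n < e i" by auto
      then have "n = i + m * (n div m)" using mult_div_mod_eq[of m n] by simp
      moreover from this have "m * (n div m) < m * ?k" using n ei by linarith
      ultimately show "n \<in> (\<lambda>l. i + m * l) ` {..<?k}" by auto
    next
      fix n assume "n \<in> (\<lambda>l. i + m * l) ` {..<?k}"
      then obtain l where l: "n = i + m * l" "l < ?k" by auto
      then have "m * l < m * ?k" using m_pos by simp
      then have "n < e i" using l ei by linarith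
      then show "n \<in> ?G i" using l i by simp
    qed
    moreover have "inj_on (\<lambda>l. i + m * l) {..<?k}" using m_pos by (auto intro: inj_onI)
    ultimately have "card (?G i) = ?k" by (simp add: card_image)
    then show ?thesis using ei by simp
  qed
  show ?thesis
    unfolding gaps card_gaps sum_distrib_left sum.distrib[symmetric]
    using class_gaps by (rule sum.cong[OF refl])
qed

end

lemma semigroup_eqI:
  assumes "semigroup_modulo S m" "semigroup_modulo T m"
    and "\<And>i. 0 < i \<Longrightarrow> i < m \<Longrightarrow> standard_basis S m i = standard_basis T m i"
  shows "S = T"
proof -
  interpret S: semigroup_modulo S m by fact
  interpret T: semigroup_modulo T m by fact
  have "n \<in> S \<longleftrightarrow> n \<in> T" for n
    unfolding S.mem_iff T.mem_iff using assms(3)[of "n mod m"] S.m_pos by (cases "n mod m = 0") auto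
  then show ?thesis by blast
qed

text \<open>Counting the elements below \<open>a\<close> instead of the gaps above it: the gaps below \<open>a\<close> are the
  complement of the former in \<open>{..<a}\<close>.\<close>

lemma card_gaps_above:
  assumes "finite (- S)" and "a \<in> S"
  shows "int (card {b. b \<notin> S \<and> a < b}) = int (card (- S)) + int (card {n \<in> S. n < a}) - int a"
proof -
  have "card (- S) = card {b. b \<notin> S \<and> a < b} + card {b. b \<notin> S \<and> b < a}"
  proof -
    have "a < b \<or> b < a" if "b \<notin> S" for b
      using that assms(2) by (cases b a rule: linorder_cases) auto
    then have S: "- S = {b. b \<notin> S \<and> a < b} \<union> {b. b \<notin> S \<and> b < a}"
      by blast
    have "finite {b. b \<notin> S \<and> a < b}" "finite {b. b \<notin> S \<and> b < a}"
      using assms(1) by (auto intro!: finite_subset[of _ "- S"])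
    then show ?thesis
      by (subst S, intro card_Un_disjoint) auto
  qed
  moreover have "a = card {n \<in> S. n < a} + card {b. b \<notin> S \<and> b < a}"
  proof -
    have "{..<a} = {n \<in> S. n < a} \<union> {b. b \<notin> S \<and> b < a}" by auto
    moreover have "card \<dots> = card {n \<in> S. n < a} + card {b. b \<notin> S \<and> b < a}"
      by (rule card_Un_disjoint) auto
    ultimately show ?thesis by (metis card_lessThan)
  qed
  ultimately show ?thesis by linarith
qed

lemma ewt_eq_sum:
  assumes "finite (- S)" and "minimally_generates A S" and "finite A" and "0 \<notin> A"
  shows "int (ewt S) =
    (\<Sum>a\<in>A. int (card (- S)) + int (card {n \<in> S. n < a}) - int a)"
proof -
  have A: "A \<subseteq> S"
    using assms(2) generated_superset unfolding minimally_generates_def by blast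
  have pos: "0 < a" if "a \<in> A" for a
    using assms(4) that by (cases a) auto
  have "{(a, b). 0 < a \<and> a < b \<and> a \<in> minimal_generators S \<and> b \<notin> S}
      = Sigma A (\<lambda>a. {b. b \<notin> S \<and> a < b})"
    using pos minimal_generators_eq[OF assms(2)] by auto
  moreover have "finite {b. b \<notin> S \<and> a < b}" for a
    using assms(1) by (rule finite_subset[rotated]) auto
  ultimately have "ewt S = (\<Sum>a\<in>A. card {b. b \<notin> S \<and> a < b})"
    unfolding ewt_def using assms(3) by (simp add: card_SigmaI)
  then show ?thesis using card_gaps_above[OF assms(1)] A by (simp add: subset_iff)
qed

section \<open>The Carvalho--Torres semigroup\<close>

locale carvalho_torres_parameters =
  fixes N \<gamma> t :: nat
  assumes N: "N \<ge> 2" and g: "\<gamma> > 0" and t: "t \<ge> 2 * \<gamma> + 3" and odd_t: "odd t"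
begin

abbreviation "q \<equiv> N * t - 1"
abbreviation "h \<equiv> (2 * \<gamma> + 1) * N"
abbreviation "gens \<equiv> {2 * N, h, q}"

lemma q_eq: "q + 1 = N * t"
  using N t by simp

lemma int_q: "int q = int N * int t - 1"
  using q_eq by (metis add_diff_cancel_right' of_nat_1 of_nat_add of_nat_mult)

lemma mult_q: "y * q + y = N * (y * t)"
proof -
  have "y * q + y = y * (q + 1)" by simp
  then show ?thesis unfolding q_eq by (simp add: mult_ac)
qed

lemma h_less_q: "h < q" and two_N_less_h: "2 * N < h"
proof -
  have "(2 * \<gamma> + 3) * N \<le> N * t" using t by (metis mult.commute mult_le_mono2)
  then show "h < q" using N q_eq by (simp add: algebra_simps)
  have "N \<le> \<gamma> * N" using g by simp
  then show "2 * N < h" using N by (simp add: algebra_simps)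
qed

lemma mult_cong:
  "odd x \<Longrightarrow> [N * x = N] (mod 2 * N)" "even x \<Longrightarrow> [N * x = 0] (mod 2 * N)"
proof -
  assume "odd x"
  then obtain k where "x = 2 * k + 1" by (rule oddE)
  then have "N * x = N + k * (2 * N)" by simp
  then show "[N * x = N] (mod 2 * N)" by (simp add: cong_def)
next
  assume "even x"
  then obtain k where "x = 2 * k" by (rule evenE)
  then have "N * x = k * (2 * N)" by simp
  then show "[N * x = 0] (mod 2 * N)" by (metis cong_0_iff dvd_triv_right)
qed

lemma not_cong_half: "\<not> [N - j = 2 * N - j] (mod 2 * N)" if "j < N"
proof
  assume "[N - j = 2 * N - j] (mod 2 * N)"
  then have "[N - j + j = 2 * N - j + j] (mod 2 * N)" using cong_add_rcancel_nat by blast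
  then show False using that N by (simp add: cong_def)
qed

text \<open>The conditions prescribe, for every \<open>j\<close>, the unordered pair of the basis elements for \<open>N - j\<close>
  and \<open>2 N - j\<close>. As these residues differ modulo \<open>2 N\<close>, two solutions cannot order the pair
  differently.\<close>

lemma basis_unique:
  assumes S: "is_carvalho_torres N \<gamma> t S" and T: "is_carvalho_torres N \<gamma> t T"
  shows "S = T"
proof (rule semigroup_eqI[where m = "2 * N"])
  show SM: "semigroup_modulo S (2 * N)" and TM: "semigroup_modulo T (2 * N)"
    using S T N by (auto simp: semigroup_modulo_def is_carvalho_torres_def)
  let ?e = "standard_basis S (2 * N)" and ?f = "standard_basis T (2 * N)"
  have half: "?e (N - j) = ?f (N - j) \<and> ?e (2 * N - j) = ?f (2 * N - j)"
    if j: "1 \<le> j" "j \<le> N - 1" for j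
  proof -
    have r: "0 < N - j" "N - j < 2 * N" "0 < 2 * N - j" "2 * N - j < 2 * N" "j < N"
      using j by auto
    note c = semigroup_modulo.standard_basis_props(2)[OF SM r(1,2)]
      semigroup_modulo.standard_basis_props(2)[OF SM r(3,4)]
      semigroup_modulo.standard_basis_props(2)[OF TM r(1,2)]
      semigroup_modulo.standard_basis_props(2)[OF TM r(3,4)]
    have "?e (N - j) \<noteq> ?f (2 * N - j)" "?e (2 * N - j) \<noteq> ?f (N - j)"
      using c not_cong_half[OF r(5)] by (metis cong_trans cong_sym)+
    moreover have "min (?e (N - j)) (?e (2 * N - j)) = min (?f (N - j)) (?f (2 * N - j))"
      "?e (N - j) + ?e (2 * N - j) = ?f (N - j) + ?f (2 * N - j)"
      using S T j by (auto simp: is_carvalho_torres_def Let_def)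
    ultimately show ?thesis by (auto simp: min_def split: if_splits)
  qed
  fix i assume i: "0 < i" "i < 2 * N"
  consider "i < N" | "i = N" | "N < i" by linarith
  then show "?e i = ?f i"
  proof cases
    case 1 then show ?thesis using half[of "N - i"] i by simp
  next
    case 2 then show ?thesis using S T by (simp add: is_carvalho_torres_def Let_def)
  next
    case 3 then show ?thesis using half[of "2 * N - i"] i by simp
  qed
qed

text \<open>Let \<open>y\<close> be the number of copies of \<open>q\<close> in \<open>n\<close>. As \<open>q + 1\<close> is a multiple of \<open>N\<close>, adding \<open>y + j\<close>
  to both sides of the congruence leaves \<open>j\<close> on the left and \<open>y\<close> on the right, up to multiples of
  \<open>N\<close>. So \<open>y\<close> is \<open>j\<close> plus a multiple of \<open>N\<close>.\<close>

lemma generated_minimum: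
  assumes n: "n \<in> generated gens" and \<epsilon>: "\<epsilon> \<le> 1" and j: "j < N"
    and cong: "[n = \<epsilon> * h + j * q] (mod 2 * N)"
  shows "\<epsilon> * h + j * q \<le> n"
proof -
  obtain a b y where abc: "n = a * (2 * N) + b * h + y * q"
    using n unfolding generated_triple by blast
  have c0: "[n + y + j = \<epsilon> * h + j * q + y + j] (mod 2 * N)"
    using cong by (intro cong_add) auto
  have n': "n + y + j = N * (2 * a + b * (2 * \<gamma> + 1) + y * t) + j"
    using mult_q[of y] unfolding abc by (simp add: algebra_simps)
  have w': "\<epsilon> * h + j * q + y + j = N * (\<epsilon> * (2 * \<gamma> + 1) + j * t) + y"
    using mult_q[of j] by (simp add: algebra_simps)
  from c0 have c: "[N * (2 * a + b * (2 * \<gamma> + 1) + y * t) + j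
      = N * (\<epsilon> * (2 * \<gamma> + 1) + j * t) + y] (mod 2 * N)"
    by (simp only: n' w')
  then have "[N * (2 * a + b * (2 * \<gamma> + 1) + y * t) + j
      = N * (\<epsilon> * (2 * \<gamma> + 1) + j * t) + y] (mod N)"
    using cong_dvd_modulus_nat dvd_triv_right by blast
  then have "j = y mod N" using j by (simp add: cong_def)
  then have "y = j + N * (y div N)" by simp
  show ?thesis
  proof (cases "y div N = 0")
    \<comment> \<open>Both sides use \<open>q\<close> exactly \<open>j\<close> times, so parity shows that \<open>n\<close> uses \<open>h\<close> at least \<open>\<epsilon>\<close> times.\<close>
    case True
    then have y: "y = j" using \<open>y = j + N * (y div N)\<close> by simp
    then have "[N * (2 * a + b * (2 * \<gamma> + 1) + y * t)
        = N * (\<epsilon> * (2 * \<gamma> + 1) + j * t)] (mod N * 2)"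
      using c cong_add_rcancel_nat by (simp add: mult.commute)
    then have "[2 * a + b * (2 * \<gamma> + 1) + j * t = \<epsilon> * (2 * \<gamma> + 1) + j * t] (mod 2)"
      using N y by (simp add: cong_def flip: mult_mod_right)
    then have "even (2 * a + b * (2 * \<gamma> + 1) + j * t) = even (\<epsilon> * (2 * \<gamma> + 1) + j * t)"
      by (metis cong_dvd_iff)
    then have "even b = even \<epsilon>" by auto
    then have "\<epsilon> \<le> b" using \<epsilon> by (cases b; cases \<epsilon>) auto
    then show ?thesis unfolding abc y by (simp add: trans_le_add2)
  next
    \<comment> \<open>The \<open>N\<close> additional copies of \<open>q\<close> already exceed \<open>h\<close>.\<close>
    case False
    then have "N \<le> N * (y div N)" by simp
    then have "j + N \<le> y" using \<open>y = j + N * (y div N)\<close> by linarith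
    then have "(j + N) * q \<le> y * q" by simp
    moreover have "q \<le> N * q" using N by simp
    moreover have "\<epsilon> * h \<le> h" using \<epsilon> by simp
    ultimately show ?thesis using h_less_q abc unfolding add_mult_distrib by linarith
  qed
qed

lemma two_odd_representation:
  assumes "even x \<or> 2 * \<gamma> + 1 \<le> x"
  shows "\<exists>k l. x = k * 2 + l * (2 * \<gamma> + 1)"
proof (cases "even x")
  case True
  then show ?thesis by (intro exI[of _ "x div 2"] exI[of _ 0]) auto
next
  case False
  then show ?thesis using assms
    by (intro exI[of _ "(x - (2 * \<gamma> + 1)) div 2"] exI[of _ 1]) auto
qed

text \<open>Since \<open>q\<close> is congruent to \<open>-1\<close> modulo \<open>N\<close>, subtracting a suitable number \<open>y \<le> N\<close> of copies of
  \<open>q\<close> from a large \<open>n\<close> leaves a multiple \<open>N r\<close>. The odd numbers up to \<open>2 \<gamma> - 1\<close> are the only gaps of the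
  semigroup generated by \<open>2\<close> and \<open>2 \<gamma> + 1\<close>, so \<open>r \<ge> 2 \<gamma>\<close> suffices.\<close>

lemma generated_numerical: "numerical_semigroup (generated gens)"
proof -
  have "n \<in> generated gens" if n: "N * q + 2 * \<gamma> * N \<le> n" for n
  proof -
    define y where "y = N - n mod N"
    define k where "k = n div N + 1"
    have "n mod N \<le> N" using N by (intro less_imp_le mod_less_divisor) simp
    moreover have "N * k = N * (n div N) + N" unfolding k_def by simp
    ultimately have y: "y \<le> N" "n + y = N * k"
      using mult_div_mod_eq[of N n] unfolding y_def by linarith+
    note yq = mult_q[of y]
    have "y * q \<le> N * q" using y by simp
    then have "N * (y * t) + 2 * \<gamma> * N \<le> N * k" using n yq y by linarith
    then have "N * (y * t + 2 * \<gamma>) \<le> N * k" by (simp add: algebra_simps)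
    then have "y * t + 2 * \<gamma> \<le> k" using N by simp
    then obtain r where r: "k = y * t + r" "2 * \<gamma> \<le> r"
      using le_Suc_ex[of "y * t + 2 * \<gamma>" k] by (metis add.assoc le_add1)
    have n_eq: "n = N * r + y * q"
      using y yq r by (simp add: algebra_simps)
    have "even r \<or> 2 * \<gamma> + 1 \<le> r" using r by (cases "r = 2 * \<gamma>") auto
    then obtain a b where "r = a * 2 + b * (2 * \<gamma> + 1)"
      using two_odd_representation by blast
    then have "n = a * (2 * N) + b * h + y * q" using n_eq by (simp add: algebra_simps)
    then show ?thesis unfolding generated_triple by blast
  qed
  then have "- generated gens \<subseteq> {..< N * q + 2 * \<gamma> * N}" by (auto simp: not_le[symmetric])
  then show ?thesis
    unfolding numerical_semigroup_def using submonoid_generated finite_subset by blast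
qed

lemma generated_basis:
  assumes "0 < i" "i < 2 * N" "\<epsilon> \<le> 1" "j < N" "[\<epsilon> * h + j * q = i] (mod 2 * N)"
  shows "standard_basis (generated gens) (2 * N) i = \<epsilon> * h + j * q"
proof (rule standard_basis_eqI)
  have "\<epsilon> * h + j * q = 0 * (2 * N) + \<epsilon> * h + j * q" by simp
  then show "\<epsilon> * h + j * q \<in> generated gens"
    unfolding generated_triple by blast
  show "\<epsilon> * h + j * q \<le> n" if "n \<in> generated gens" "[n = i] (mod 2 * N)" for n
    using generated_minimum assms that cong_trans cong_sym by blast
qed (use assms in auto)

text \<open>Adding \<open>j\<close> to \<open>\<epsilon> h + j q\<close> gives \<open>N\<close> times a number with the parity of \<open>\<epsilon> + j\<close>, because
  \<open>t\<close> is odd. So the sum lies in the class of \<open>N - j\<close> or of \<open>2 N - j\<close>, according to that parity.\<close>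

lemma generated_is_carvalho_torres: "is_carvalho_torres N \<gamma> t (generated gens)"
proof -
  let ?e = "standard_basis (generated gens) (2 * N)"
  have two_N: "2 * N \<in> generated gens" using generated_superset by blast
  have e_N: "?e N = h"
    using generated_basis[of N 1 0] mult_cong(1)[of "2 * \<gamma> + 1"] N by (simp add: mult.commute)
  have half: "min (?e (N - j)) (?e (2 * N - j)) = q * j \<and>
      ?e (N - j) + ?e (2 * N - j) = 2 * j * q + h" if j: "1 \<le> j" "j \<le> N - 1" for j
  proof -
    have r: "0 < N - j" "N - j < 2 * N" "0 < 2 * N - j" "2 * N - j < 2 * N" "j < N"
      using j by auto
    have w: "\<epsilon> * h + j * q + j = N * (\<epsilon> * (2 * \<gamma> + 1) + j * t)" for \<epsilon>
      using mult_q[of j] by (simp add: algebra_simps)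
    have lo: "?e (N - j) = \<epsilon> * h + j * q" if "\<epsilon> \<le> 1" "odd (\<epsilon> + j)" for \<epsilon>
    proof (rule generated_basis[OF r(1,2) that(1) r(5)])
      have "[N * (\<epsilon> * (2 * \<gamma> + 1) + j * t) = N] (mod 2 * N)"
        by (rule mult_cong(1)) (use that odd_t in auto)
      then have "[\<epsilon> * h + j * q + j = N - j + j] (mod 2 * N)" using w[of \<epsilon>] r(5) by simp
      then show "[\<epsilon> * h + j * q = N - j] (mod 2 * N)" using cong_add_rcancel_nat by blast
    qed
    have hi: "?e (2 * N - j) = \<epsilon> * h + j * q" if "\<epsilon> \<le> 1" "even (\<epsilon> + j)" for \<epsilon>
    proof (rule generated_basis[OF r(3,4) that(1) r(5)])
      have "[N * (\<epsilon> * (2 * \<gamma> + 1) + j * t) = 0] (mod 2 * N)"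
        by (rule mult_cong(2)) (use that odd_t in auto)
      then have "[\<epsilon> * h + j * q + j = 2 * N - j + j] (mod 2 * N)"
        using w[of \<epsilon>] r(5) by (simp add: cong_def)
      then show "[\<epsilon> * h + j * q = 2 * N - j] (mod 2 * N)" using cong_add_rcancel_nat by blast
    qed
    show ?thesis
    proof (cases "odd j")
      case True
      then show ?thesis using lo[of 0] hi[of 1] by (simp add: mult.commute)
    next
      case False
      then show ?thesis using lo[of 1] hi[of 0] by (simp add: mult.commute)
    qed
  qed
  show ?thesis
    unfolding is_carvalho_torres_def Let_def
  proof (intro conjI allI impI generated_numerical two_N e_N)
    fix j assume j: "1 \<le> j \<and> j \<le> N - 1"
    show "min (?e (N - j)) (?e (2 * N - j)) = q * j"
      by (rule conjunct1[OF half[OF conjunct1[OF j] conjunct2[OF j]]])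
    show "?e (N - j) + ?e (2 * N - j) = 2 * j * q + h"
      by (rule conjunct2[OF half[OF conjunct1[OF j] conjunct2[OF j]]])
  qed
qed

lemma carvalho_torres_eq: "carvalho_torres N \<gamma> t = generated gens"
  unfolding carvalho_torres_def
proof (rule the_equality)
  show "is_carvalho_torres N \<gamma> t (generated gens)"
    by (rule generated_is_carvalho_torres)
  then show "S = generated gens" if "is_carvalho_torres N \<gamma> t S" for S
    using that by (rule basis_unique[rotated])
qed

lemma gens_minimal: "minimally_generates gens (generated gens)"
proof (rule minimally_generatesI)
  have "{a, b, c} - {a} = {b, c} \<and> {a, b, c} - {b} = {a, c} \<and> {a, b, c} - {c} = {a, b}"
    if "a < b" "b < c" for a b c :: nat
    using that by auto
  from this[OF two_N_less_h h_less_q]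
  have diff: "gens - {2 * N} = {h, q}" "gens - {h} = {2 * N, q}" "gens - {q} = {2 * N, h}"
    by blast+
  have "2 * N \<notin> generated {h, q}"
  proof
    assume "2 * N \<in> generated {h, q}"
    then obtain k l where kl: "2 * N = k * h + l * q" unfolding generated_pair by blast
    then have "k * h < h" "l * q < q" using h_less_q two_N_less_h by linarith+
    then have "k = 0" "l = 0" by simp_all
    then show False using kl N by simp
  qed
  moreover have "h \<notin> generated {2 * N, q}"
  proof
    assume "h \<in> generated {2 * N, q}"
    then obtain k l where kl: "h = k * (2 * N) + l * q" unfolding generated_pair by blast
    then have "l * q < q" using h_less_q by linarith
    then have "l = 0" by simp
    then have "N * (2 * \<gamma> + 1) = N * (2 * k)" using kl by (simp add: algebra_simps)
    then have "2 * \<gamma> + 1 = 2 * k" using N unfolding mult_cancel1 by auto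
    then show False by presburger
  qed
  moreover have "q \<notin> generated {2 * N, h}"
  proof
    assume "q \<in> generated {2 * N, h}"
    then obtain k l where "q = k * (2 * N) + l * h" unfolding generated_pair by blast
    then have "N dvd q" by simp
    moreover have "N dvd q + 1" using q_eq by simp
    ultimately have "N dvd 1" using dvd_add_right_iff by blast
    then show False using N by simp
  qed
  ultimately show "a \<notin> generated (gens - {a})" if "a \<in> gens" for a
    using that diff by (elim insertE emptyE) (simp_all only: not_False_eq_True)
qed simp

lemma generated_eq_sum_set:
  "generated gens = {x * N + y | x y. x \<in> generated {2, 2 * \<gamma> + 1} \<and> y \<in> generated {q}}"
proof -
  have "k * (2 * N) + l * h + z * q = (k * 2 + l * (2 * \<gamma> + 1)) * N + z * q" for k l z
    by (simp add: algebra_simps)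
  then show ?thesis
    unfolding generated_triple generated_pair generated_singleton by auto
qed

text \<open>Pairing the residues \<open>N - j\<close> and \<open>2 N - j\<close> makes the sum of the standard basis depend on the
  prescribed pair sums alone. The factor \<open>2\<close> clears the denominator of \<open>N choose 2\<close>.\<close>

lemma genus: "2 * int (card (- generated gens)) = int N * (int N - 1) * int t + 2 * int N * (int \<gamma> - 1) + 2"
proof -
  let ?e = "standard_basis (generated gens) (2 * N)"
  interpret semigroup_modulo "generated gens" "2 * N"
    using N generated_is_carvalho_torres by unfold_locales (auto simp: is_carvalho_torres_def)
  have ct: "?e N = h" "\<And>j. 1 \<le> j \<Longrightarrow> j \<le> N - 1 \<Longrightarrow> ?e (N - j) + ?e (2 * N - j) = 2 * j * q + h"
    using generated_is_carvalho_torres by (auto simp: is_carvalho_torres_def Let_def)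
  have "{1..<2 * N} = {1..<N} \<union> ({N} \<union> {N+1..<2*N})" using N by auto
  then have "(\<Sum>i=1..<2*N. ?e i) = (\<Sum>i=1..<N. ?e i) + (?e N + (\<Sum>i=N+1..<2*N. ?e i))"
    by (simp add: sum.union_disjoint)
  moreover have "(\<Sum>i=1..<N. ?e i) = (\<Sum>j=1..<N. ?e (N - j))"
    by (rule sum.reindex_bij_witness[of _ "\<lambda>j. N - j" "\<lambda>j. N - j"]) auto
  moreover have "(\<Sum>i=N+1..<2*N. ?e i) = (\<Sum>j=1..<N. ?e (2 * N - j))"
    by (rule sum.reindex_bij_witness[of _ "\<lambda>j. 2 * N - j" "\<lambda>j. 2 * N - j"]) auto
  moreover have "(\<Sum>j=1..<N. ?e (N - j)) + (\<Sum>j=1..<N. ?e (2 * N - j)) = (\<Sum>j=1..<N. 2 * j * q + h)"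
    unfolding sum.distrib[symmetric] using ct(2) by (intro sum.cong) auto
  ultimately have sum_e: "(\<Sum>i=1..<2*N. ?e i) = (\<Sum>j=1..<N. 2 * j * q + h) + h"
    using ct(1) by simp
  have gauss: "2 * (\<Sum>i=1..<k. int i) = int k * (int k - 1)" if "1 \<le> k" for k
    using that by (induction k rule: dec_induct) (auto simp: algebra_simps)
  have "int (\<Sum>j=1..<N. 2 * j * q + h) = (2 * (\<Sum>j=1..<N. int j)) * int q + (int N - 1) * int h"
    using N by (simp add: sum.distrib sum_distrib_left sum_distrib_right of_nat_diff)
  also have "\<dots> = int N * (int N - 1) * int q + (int N - 1) * int h"
    using gauss[of N] N by simp
  finally have s: "int (\<Sum>j=1..<N. 2 * j * q + h) = int N * (int N - 1) * int q + (int N - 1) * int h" .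
  have "2 * (\<Sum>i=1..<2*N. int i) = 2 * int N * (2 * int N - 1)"
    using gauss[of "2 * N"] N by simp
  then have s2: "(\<Sum>i=1..<2*N. int i) = int N * (2 * int N - 1)" by simp
  have "int (2 * N * card (- generated gens) + (\<Sum>i=1..<2*N. i)) = int ((\<Sum>j=1..<N. 2 * j * q + h) + h)"
    using genus_standard_basis sum_e by simp
  then have "2 * int N * int (card (- generated gens)) + int N * (2 * int N - 1)
     = int N * (int N - 1) * int q + (int N - 1) * int h + int h"
    using s s2 by (simp only: of_nat_add of_nat_mult of_nat_sum of_nat_numeral)
  then have "int N * (2 * int (card (- generated gens)))
     = int N * (int N * (int N - 1) * int t + 2 * int N * (int \<gamma> - 1) + 2)"
    unfolding int_q by (simp add: algebra_simps)
  then show ?thesis using N by simp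
qed

text \<open>Below \<open>q\<close> only the generators \<open>2 N\<close> and \<open>h\<close> can occur, so the semigroup is \<open>N\<close> times the one
  generated by \<open>2\<close> and \<open>2 \<gamma> + 1\<close>.\<close>

lemma elements_below:
  assumes "a \<le> q"
  shows "{n \<in> generated gens. n < a} = (\<lambda>x. N * x) ` {x. N * x < a \<and> (even x \<or> 2 * \<gamma> + 1 \<le> x)}"
proof (intro equalityI subsetI)
  fix n assume "n \<in> {n \<in> generated gens. n < a}"
  then obtain k l z where n: "n = k * (2 * N) + l * h + z * q" "n < a"
    unfolding generated_triple by blast
  then have "z = 0" using assms by (cases z) simp_all
  then have "n = N * (k * 2 + l * (2 * \<gamma> + 1))" using n by (simp add: algebra_simps)
  moreover have "even (k * 2 + l * (2 * \<gamma> + 1)) \<or> 2 * \<gamma> + 1 \<le> k * 2 + l * (2 * \<gamma> + 1)"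
    by (cases l) auto
  ultimately show "n \<in> (\<lambda>x. N * x) ` {x. N * x < a \<and> (even x \<or> 2 * \<gamma> + 1 \<le> x)}"
    using n(2) by blast
next
  fix n assume "n \<in> (\<lambda>x. N * x) ` {x. N * x < a \<and> (even x \<or> 2 * \<gamma> + 1 \<le> x)}"
  then obtain x where x: "n = N * x" "n < a" "even x \<or> 2 * \<gamma> + 1 \<le> x" by blast
  then obtain k l where "x = k * 2 + l * (2 * \<gamma> + 1)"
    using two_odd_representation by blast
  then have "n = k * (2 * N) + l * h + 0 * q" using x by (simp add: algebra_simps)
  then show "n \<in> {n \<in> generated gens. n < a}" using x(2) unfolding generated_triple by blast
qed

lemma card_elements_below:
  assumes "a \<le> q"
  shows "card {n \<in> generated gens. n < a} = card {x. N * x < a \<and> (even x \<or> 2 * \<gamma> + 1 \<le> x)}"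
  unfolding elements_below[OF assms] using N by (intro card_image inj_onI) auto

lemma card_below_generators:
  "card {n \<in> generated gens. n < 2 * N} = 1"
  "card {n \<in> generated gens. n < h} = \<gamma> + 1"
  "card {n \<in> generated gens. n < q} = t - \<gamma>"
proof -
  have "{x. N * x < 2 * N \<and> (even x \<or> 2 * \<gamma> + 1 \<le> x)} = {0}"
    using N g by (auto simp: mult.commute[of N] less_2_cases_iff)
  then show "card {n \<in> generated gens. n < 2 * N} = 1"
    using card_elements_below[OF less_imp_le[OF less_trans[OF two_N_less_h h_less_q]]] by simp
  have evens: "card {x. x < 2 * \<gamma> + 1 \<and> even x} = \<gamma> + 1"
  proof -
    have "{x. x < 2 * \<gamma> + 1 \<and> even x} = (\<lambda>y. 2 * y) ` {..\<gamma>}" by (auto elim!: evenE)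
    then show ?thesis by (simp add: card_image inj_on_def)
  qed
  have "{x. N * x < h \<and> (even x \<or> 2 * \<gamma> + 1 \<le> x)} = {x. x < 2 * \<gamma> + 1 \<and> even x}"
    using N by (auto simp: mult.commute[of N] simp del: mult_Suc)
  then show "card {n \<in> generated gens. n < h} = \<gamma> + 1"
    using card_elements_below[of h] h_less_q evens by simp
  have below_q: "N * x < q \<longleftrightarrow> x < t" for x
  proof
    assume "N * x < q"
    then have "N * x < N * t" using q_eq by linarith
    then show "x < t" by simp
  next
    assume "x < t"
    then have "N * (x + 1) \<le> N * t" by (intro mult_le_mono2) simp
    then show "N * x < q" using q_eq N by simp
  qed
  have "{x. x < t \<and> (even x \<or> 2 * \<gamma> + 1 \<le> x)}
      = {x. x < 2 * \<gamma> + 1 \<and> even x} \<union> {2 * \<gamma> + 1..<t}"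
    using t by auto
  moreover have "card ({x. x < 2 * \<gamma> + 1 \<and> even x} \<union> {2 * \<gamma> + 1..<t})
      = card {x. x < 2 * \<gamma> + 1 \<and> even x} + card {2 * \<gamma> + 1..<t}"
    by (rule card_Un_disjoint) auto
  ultimately have "card {x. x < t \<and> (even x \<or> 2 * \<gamma> + 1 \<le> x)} = t - \<gamma>"
    using evens t by simp
  then show "card {n \<in> generated gens. n < q} = t - \<gamma>"
    unfolding card_elements_below[OF order_refl] below_q .
qed

lemma ewt_generated:
  "int (ewt (generated gens))
     = (3 * int (N choose 2) - (int N - 1)) * int t + int N * int \<gamma> - 6 * (int N - 1)"
proof -
  have "finite (- generated gens)" "0 \<notin> gens"
    using generated_numerical N h_less_q two_N_less_h by (auto simp: numerical_semigroup_def)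
  then have ewt: "int (ewt (generated gens))
      = (\<Sum>a\<in>gens. int (card (- generated gens)) + int (card {n \<in> generated gens. n < a}) - int a)"
    using ewt_eq_sum gens_minimal by blast
  have "sum f {a, b, c} = f a + f b + f c" if "a < b" "b < c" for a b c :: nat and f :: "nat \<Rightarrow> int"
    using that by simp
  note sum_gens = this[OF two_N_less_h h_less_q]
  have "int (t - \<gamma>) = int t - int \<gamma>" using t by simp
  then have "int (ewt (generated gens)) = 3 * int (card (- generated gens))
      + 2 + int t - 2 * int N - int h - int q"
    unfolding ewt sum_gens card_below_generators by simp
  moreover have choose: "2 * int (N choose 2) = int N * (int N - 1)"
  proof -
    have "even (N * (N - 1))" using N by (cases "even N") auto
    then have "2 * (N choose 2) = N * (N - 1)" by (simp only: choose_two dvd_mult_div_cancel)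
    then have "int (2 * (N choose 2)) = int (N * (N - 1))" by presburger
    then show ?thesis using N by (simp add: of_nat_diff)
  qed
  then have "int (card (- generated gens)) = int (N choose 2) * int t + int N * (int \<gamma> - 1) + 1"
    using genus unfolding choose[symmetric] by (simp only: mult.assoc)
  ultimately show ?thesis unfolding int_q by (simp add: algebra_simps)
qed

end

theorem proposition5p14:
  fixes N \<gamma> t :: nat
  assumes "N \<ge> 2" and "\<gamma> > 0" and "t \<ge> 2 * \<gamma> + 3" and "odd t"
  shows "let U\<^sub>0 = carvalho_torres N \<gamma> t in
         minimally_generates {2 * N, (2 * \<gamma> + 1) * N, N * t - 1} U\<^sub>0 \<and>
         U\<^sub>0 = {x * N + y | x y. x \<in> generated {2, 2 * \<gamma> + 1} \<and> y \<in> generated {N * t - 1}} \<and>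
         int (ewt U\<^sub>0) = (3 * int (N choose 2) - (int N - 1)) * int t + int N * int \<gamma> - 6 * (int N - 1)"
proof -
  interpret carvalho_torres_parameters N \<gamma> t by unfold_locales (use assms in auto)
  show ?thesis
    unfolding Let_def carvalho_torres_eq
    by (rule conjI[OF gens_minimal conjI[OF generated_eq_sum_set ewt_generated]])
qed

end
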